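(* Fix $\lambda>0$ and $z>0$. The random time $\sigma_z^\lambda$ is a totally inaccessible stopping time with respect to the filtration $\mathbb{F}^{\xi^{\lambda,z},c}$.
   Context: Let $B=(B_t)_{t\ge 0}$ be a standard Brownian motion started at $0$ on a complete probability space $(\Omega,\mathcal{F},\mathbb{P})$, with $\mathcal{N}_{\mathbb{P}}$ the collection of $\mathbb{P}$-null sets. For $\lambda>0$, $z>0$, put $B^\lambda_t=B_t+\lambda t$, $\sigma_z^\lambda=\sup\{t>0: B^\lambda_t=z\}$ (almost surely finite), and $\xi^{\lambda,z}_t=B^\lambda_{t\wedge\sigma_z^\lambda}$, $t\ge 0$. The completed natural filtration is $\mathbb{F}^{\xi^{\lambda,z},c}$ with $\mathcal{F}^{\xi^{\lambda,z},c}_t=\sigma(\xi^{\lambda,z}_s,\,s\le t)\vee\mathcal{N}_{\mathbb{P}}$. A stopping time $T$ is totally inaccessible if $\mathbb{P}(T=S<\infty)=0$ for every predictable stopping time $S$. *)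

theory Defs
  imports "HOL-Probability.Probability"
begin

text \<open>
  Processes are indexed by real times, of which only \<open>t \<ge> 0\<close> matter.  Random times take values
  in \<open>[0, \<infinity>]\<close>, i.e. in \<^typ>\<open>ennreal\<close>; in order to use the library's \<^const>\<open>stopping_time\<close>,
  whose filtrations are indexed by the type of the random times, filtrations are
  indexed by \<^typ>\<open>ennreal\<close> as well.  The condition \<open>{T \<le> t} \<in> F t\<close> is void for \<open>t = \<infinity>\<close>.
\<close>

text \<open>The initial value and the continuity of the paths are only required almost surely.\<close>

locale standard_brownian_motion = prob_space M for M :: "'a measure" +
  fixes B :: "real \<Rightarrow> 'a \<Rightarrow> real"
  assumes random_variable_B: "0 \<le> t \<Longrightarrow> B t \<in> borel_measurable M"
    and start_zero: "AE \<omega> in M. B 0 \<omega> = 0"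
    and indep_increments:
      "0 \<le> \<tau> 0 \<Longrightarrow> (\<And>i. i < n \<Longrightarrow> \<tau> i \<le> \<tau> (Suc i)) \<Longrightarrow>
        indep_vars (\<lambda>_. borel) (\<lambda>i \<omega>. B (\<tau> (Suc i)) \<omega> - B (\<tau> i) \<omega>) {..<(n::nat)}"
    and normal_increments:
      "0 \<le> s \<Longrightarrow> s < t \<Longrightarrow>
        distributed M lborel (\<lambda>\<omega>. B t \<omega> - B s \<omega>) (normal_density 0 (sqrt (t - s)))"
    and continuous_paths: "AE \<omega> in M. continuous_on {0..} (\<lambda>t. B t \<omega>)"

definition drifted :: "(real \<Rightarrow> 'a \<Rightarrow> real) \<Rightarrow> real \<Rightarrow> real \<Rightarrow> 'a \<Rightarrow> real" where
  "drifted B lam t \<omega> = B t \<omega> + lam * t"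

text \<open>
  The supremum is taken in \<open>[0, \<infinity>]\<close>: it is \<open>\<infinity>\<close> if the visits to \<open>z\<close> are unbounded in time,
  and \<open>0\<close> if there are none.
\<close>

definition last_passage_time :: "(real \<Rightarrow> 'a \<Rightarrow> real) \<Rightarrow> real \<Rightarrow> 'a \<Rightarrow> ennreal" where
  "last_passage_time X z \<omega> = (SUP t \<in> {t. 0 < t \<and> X t \<omega> = z}. ennreal t)"

definition stopped_process ::
    "(real \<Rightarrow> 'a \<Rightarrow> real) \<Rightarrow> ('a \<Rightarrow> ennreal) \<Rightarrow> real \<Rightarrow> 'a \<Rightarrow> real" where
  "stopped_process X T t \<omega> = X (enn2real (min (ennreal t) (T \<omega>))) \<omega>"

definition last_passage_process ::
    "(real \<Rightarrow> 'a \<Rightarrow> real) \<Rightarrow> real \<Rightarrow> real \<Rightarrow> real \<Rightarrow> 'a \<Rightarrow> real" where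
  "last_passage_process B lam z =
    stopped_process (drifted B lam) (last_passage_time (drifted B lam) z)"

definition completed_natural_filtration ::
    "'a measure \<Rightarrow> (real \<Rightarrow> 'a \<Rightarrow> real) \<Rightarrow> ennreal \<Rightarrow> 'a measure" where
  "completed_natural_filtration M X t =
    sigma (space M)
      ({X s -` A \<inter> space M | s A. 0 \<le> s \<and> ennreal s \<le> t \<and> A \<in> sets borel} \<union> null_sets M)"

lemma filtration_completed_natural_filtration:
  "filtration (space M) (completed_natural_filtration M X)"
proof
  have gen: "{X s -` A \<inter> space M | s A. 0 \<le> s \<and> ennreal s \<le> t \<and> A \<in> sets borel} \<union> null_sets M
      \<subseteq> Pow (space M)" for t
    using sets.sets_into_space by (fastforce simp: null_sets_def)
  show "space (completed_natural_filtration M X t) = space M" for t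
    unfolding completed_natural_filtration_def using gen by (rule space_measure_of)
  show "sets (completed_natural_filtration M X s) \<subseteq> sets (completed_natural_filtration M X t)"
    if "s \<le> t" for s t
    unfolding completed_natural_filtration_def sets_measure_of[OF gen]
    using that by (intro sigma_sets_mono') (auto intro: order_trans)
qed

text \<open>
  Predictable stopping times are those announced by a sequence of stopping times.  The announcing
  properties are required almost surely.
\<close>

definition predictable_stopping_time ::
    "'a measure \<Rightarrow> (ennreal \<Rightarrow> 'a measure) \<Rightarrow> ('a \<Rightarrow> ennreal) \<Rightarrow> bool" where
  "predictable_stopping_time M F S \<longleftrightarrow>
    stopping_time F S \<and>
    (\<exists>R :: nat \<Rightarrow> 'a \<Rightarrow> ennreal.
      (\<forall>n. stopping_time F (R n)) \<and>
      (AE \<omega> in M. incseq (\<lambda>n. R n \<omega>) \<and> (\<lambda>n. R n \<omega>) \<longlonglongrightarrow> S \<omega> \<and>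
        (0 < S \<omega> \<longrightarrow> (\<forall>n. R n \<omega> < S \<omega>))))"

text \<open>
  Membership in \<^const>\<open>null_sets\<close> says that the event is measurable and has probability \<open>0\<close>;
  the equation \<open>measure M \<dots> = 0\<close> alone would hold for every non-measurable set.
\<close>

definition totally_inaccessible_stopping_time ::
    "'a measure \<Rightarrow> (ennreal \<Rightarrow> 'a measure) \<Rightarrow> ('a \<Rightarrow> ennreal) \<Rightarrow> bool" where
  "totally_inaccessible_stopping_time M F T \<longleftrightarrow>
    stopping_time F T \<and>
    (\<forall>S. predictable_stopping_time M F S \<longrightarrow>
      {\<omega> \<in> space M. T \<omega> = S \<omega> \<and> S \<omega> < \<infinity>} \<in> null_sets M)"

end

theory Submission
  imports Defs
begin

text \<open>
  Up to null sets, \<open>{\<sigma> \<le> t}\<close> is the event \<open>{\<xi>\<^sub>t = z}\<close>, since \<open>X\<^sub>t = z\<close> has probability \<open>0\<close> for the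
  drifted Brownian motion \<open>X\<close>; hence \<open>\<sigma>\<close> is a stopping time.  On \<open>{t < \<sigma>}\<close> the filtrations of
  \<open>\<xi>\<close> and of \<open>X\<close> have the same trace, so on \<open>{\<sigma> = S < \<infinity>}\<close> the stopping times announcing \<open>S\<close>,
  being smaller than \<open>\<sigma>\<close>, determine \<open>S\<close> as an optional time of \<open>X\<close>.  But \<open>X\<close> enters
  \<open>(-\<infinity>, X\<^sub>S)\<close> immediately after an optional time \<open>S\<close> almost surely, whereas \<open>X\<close> stays above \<open>z\<close>
  after the last visit \<open>\<sigma>\<close> to \<open>z\<close>.
\<close>

section \<open>Oscillation of Brownian motion on small time scales\<close>

lemma (in prob_space) normal_prob_atom:
  assumes "distributed M lborel Y (normal_density 0 \<sigma>)"
  shows "AE \<omega> in M. Y \<omega> \<noteq> c"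
proof -
  have "emeasure M (Y -` {c} \<inter> space M) = (\<integral>\<^sup>+x. ennreal (normal_density 0 \<sigma> x) * indicator {c} x \<partial>lborel)"
    by (rule distributed_emeasure[OF assms]) simp
  also have "\<dots> = 0"
    by (subst nn_integral_0_iff_AE) (auto intro!: AE_I[where N="{c}"] simp: indicator_def)
  finally have "emeasure M (Y -` {c} \<inter> space M) = 0" .
  moreover have "Y -` {c} \<inter> space M \<in> sets M"
    using distributed_measurable[OF assms] by (rule measurable_sets) simp
  ultimately show ?thesis
    by (intro AE_I[where N="Y -` {c} \<inter> space M"]) auto
qed

lemma (in prob_space) normal_prob_abs_ge:
  assumes Y: "distributed M lborel Y (normal_density 0 \<sigma>)" and "0 < \<sigma>" "0 < a"
  shows "prob {\<omega> \<in> space M. a \<le> \<bar>Y \<omega>\<bar>} \<le> \<sigma>\<^sup>2 / a\<^sup>2"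
proof -
  have m: "Y \<in> borel_measurable M"
    using distributed_measurable[OF Y] by simp
  have exp: "expectation Y = 0"
    using normal_distributed_expectation[OF \<open>0 < \<sigma>\<close> Y] .
  have "integrable lborel (\<lambda>x. normal_density 0 \<sigma> x * x^2)"
    using integrable_normal_moment[OF \<open>0 < \<sigma>\<close>, of 0 2] by simp
  then have i: "integrable M (\<lambda>\<omega>. Y \<omega> ^ 2)"
    by (subst (asm) distributed_integrable[OF Y]) auto
  show ?thesis
    using Chebyshev_inequality[OF m i \<open>0 < a\<close>] normal_distributed_variance[OF \<open>0 < \<sigma>\<close> Y]
    by (simp add: exp)
qed

text \<open>Rescaling to \<open>Y / \<sigma>\<close> gives the standard normal law, so the standard
  normal mass of \<open>{..-c}\<close> is one \<open>p\<close> that serves all scales and all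
  probability spaces at once.\<close>

lemma normal_tail_pos:
  fixes c :: real
  shows "\<exists>p>0. \<forall>(M::'a measure) Y \<sigma>. prob_space M \<longrightarrow> 0 < \<sigma> \<longrightarrow>
    distributed M lborel Y (normal_density 0 \<sigma>) \<longrightarrow>
    p \<le> measure M {\<omega> \<in> space M. Y \<omega> \<le> - c * \<sigma>}"
proof -
  define D where "D = density lborel std_normal_density"
  interpret D: prob_space D
    unfolding D_def by (rule prob_space_normal_density) simp
  have pos: "measure D {..-c} > 0"
  \<comment> \<open>Mass zero would, by strict positivity of the density, make the half-line
    Lebesgue-null, although it contains an interval of length 1.\<close>
  proof (rule ccontr)
    assume "\<not> measure D {..-c} > 0"
    then have "measure D {..-c} = 0" by (simp add: not_less measure_le_0_iff)
    then have "emeasure D {..-c} = 0"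
      by (simp add: D.emeasure_eq_measure)
    then have "(\<integral>\<^sup>+x. ennreal (std_normal_density x) * indicator {..-c} x \<partial>lborel) = 0"
      unfolding D_def by (subst (asm) emeasure_density) auto
    then have "AE x in lborel. ennreal (std_normal_density x) * indicator {..-c} x = 0"
      by (subst (asm) nn_integral_0_iff_AE)
         (auto simp: indicator_def split: if_splits elim!: eventually_mono)
    then have "AE x in lborel. x \<notin> {..-c}"
      by eventually_elim
        (use normal_density_pos[of 1 0] in \<open>auto simp: indicator_def less_le split: if_splits\<close>)
    then have "emeasure lborel {..-c} = 0"
      by (subst (asm) AE_iff_measurable[where N="{..-c}"]) auto
    moreover have "emeasure lborel {-c-1..-c} \<le> emeasure lborel {..-c}"
      by (rule emeasure_mono) auto
    ultimately show False by simp
  qed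
  show ?thesis
  proof (intro exI[of _ "measure D {..-c}"] conjI allI impI pos)
    fix M :: "'a measure" and Y :: "'a \<Rightarrow> real" and \<sigma> :: real
    assume M: "prob_space M" and s: "0 < \<sigma>" and Y: "distributed M lborel Y (normal_density 0 \<sigma>)"
    interpret prob_space M by fact
    have Z: "distributed M lborel (\<lambda>\<omega>. Y \<omega> / \<sigma>) std_normal_density"
      using normal_standard_normal_convert[OF s, of Y 0] Y by simp
    have "distr M lborel (\<lambda>\<omega>. Y \<omega> / \<sigma>) = D"
      unfolding D_def using distributed_distr_eq_density[OF Z] .
    then have "measure D {..-c} = measure (distr M lborel (\<lambda>\<omega>. Y \<omega> / \<sigma>)) {..-c}"
      by simp
    also have "\<dots> = measure M ((\<lambda>\<omega>. Y \<omega> / \<sigma>) -` {..-c} \<inter> space M)"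
      using distributed_measurable[OF Z] by (subst measure_distr) auto
    also have "(\<lambda>\<omega>. Y \<omega> / \<sigma>) -` {..-c} \<inter> space M = {\<omega> \<in> space M. Y \<omega> \<le> - c * \<sigma>}"
      using s by (auto simp: field_simps)
    finally show "measure D {..-c} \<le> measure M {\<omega> \<in> space M. Y \<omega> \<le> - c * \<sigma>}" by simp
  qed
qed

context standard_brownian_motion
begin

text \<open>Along geometrically growing times, each increment dominates the path before it with high
  probability, and the increments are independent and each very negative with a fixed probability.\<close>

lemma finite_oscillation:
  fixes lam \<epsilon> :: real
  assumes "0 < lam" "0 < \<epsilon>"
  obtains a K :: real and N :: nat where "0 < a" "1 < K"
    "\<And>u. 0 \<le> u \<Longrightarrow> prob {\<omega> \<in> space M. \<forall>i<N. - sqrt a <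
        B (u + a * K ^ Suc i) \<omega> - B u \<omega> + lam * (a * K ^ Suc i)} \<le> \<epsilon>"
proof -
  obtain p where p: "p > 0" and pP: "\<And>Y \<sigma>. 0 < \<sigma> \<Longrightarrow>
      distributed M lborel Y (normal_density 0 \<sigma>) \<Longrightarrow> p \<le> prob {\<omega> \<in> space M. Y \<omega> \<le> - 3 * \<sigma>}"
    using normal_tail_pos[of 3, where 'a='a] prob_space_axioms by blast
  have p1: "p \<le> 1"
    using pP[OF _ normal_increments[of 0 1]] by (force intro: order_trans[OF _ prob_le_1])
  \<comment> \<open>One half of \<open>\<epsilon>\<close> pays for the event that all
    \<open>N\<close> independent increments miss their lower tail.\<close>
  have "\<exists>N. (1 - p) ^ N < \<epsilon> / 2"
    using p p1 \<open>0 < \<epsilon>\<close> by (intro real_arch_pow_inv) auto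
  then obtain N where N: "(1 - p) ^ N < \<epsilon> / 2" by blast
  \<comment> \<open>The other half pays for the union bound over \<open>N\<close> Chebyshev
    estimates \<open>4 / K\<close>. The summand 2 ensures \<open>K \<ge> 2\<close>, so that each
    increment carries at least half of the variance accumulated since \<open>u\<close>.\<close>
  define K where "K = 2 + 8 * real N / \<epsilon>"
  have K2: "K \<ge> 2" using \<open>0 < \<epsilon>\<close> by (simp add: K_def)
  have K: "real N * (4 / K) \<le> \<epsilon> / 2"
    using \<open>0 < \<epsilon>\<close> K2 by (simp add: K_def field_simps)
  \<comment> \<open>Makes the last time \<open>r N\<close> equal to
    \<open>1 / (4 * lam\<^sup>2)\<close>; up to that time the drift \<open>lam * r\<close> is at
    most half of the standard deviation \<open>sqrt r\<close>.\<close>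
  define a where "a = 1 / (4 * lam\<^sup>2 * K ^ N)"
  have a: "0 < a" using \<open>0 < lam\<close> K2 by (simp add: a_def)
  define r where "r i = a * K ^ i" for i :: nat
  have r_pos: "0 < r i" for i using a K2 by (simp add: r_def)
  have r_Suc: "r (Suc i) = K * r i" for i by (simp add: r_def)
  have r_less: "r i < r (Suc i)" for i using r_pos[of i] K2 by (simp add: r_Suc)
  have r_ge: "a \<le> r i" for i using a K2 by (simp add: r_def)
  have drift: "lam * r i \<le> sqrt (r i) / 2" if "i \<le> N" for i
  proof -
    have "r i \<le> a * K ^ N" using that a K2 by (simp add: r_def power_increasing)
    also have "\<dots> = 1 / (4 * lam\<^sup>2)" using K2 by (simp add: a_def)
    finally have "lam\<^sup>2 * r i \<le> (1/2)\<^sup>2" using \<open>0 < lam\<close> by (simp add: field_simps power2_eq_square)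
    then have "sqrt (lam\<^sup>2 * r i) \<le> 1/2" by (rule real_le_lsqrt[rotated 1]) auto
    then have "lam * sqrt (r i) \<le> 1/2" using \<open>0 < lam\<close> by (simp add: real_sqrt_mult)
    then have "lam * sqrt (r i) * sqrt (r i) \<le> 1/2 * sqrt (r i)"
      using r_pos[of i] by (intro mult_right_mono) auto
    then show ?thesis using r_pos[of i] by (simp add: mult.assoc)
  qed
  show thesis
  proof (rule that[of a K N])
    fix u :: real assume u: "0 \<le> u"
    \<comment> \<open>\<open>G i\<close>: the increment ending at \<open>r (Suc i)\<close> is not
      very negative. \<open>W i\<close>: the path before that increment is too large to be dominated
      by it.\<close>
    define G where "G i = {\<omega> \<in> space M. - 2 * sqrt (r (Suc i)) < B (u + r (Suc i)) \<omega> - B (u + r i) \<omega>}" for i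
    define W where "W i = {\<omega> \<in> space M. sqrt (r (Suc i)) / 2 \<le> \<bar>B (u + r i) \<omega> - B u \<omega>\<bar>}" for i
    have [measurable]: "B (u + r i) \<in> borel_measurable M" "B u \<in> borel_measurable M" for i
      using u r_pos[of i] by (auto intro: random_variable_B)
    have [measurable]: "G i \<in> events" "W i \<in> events" for i
      unfolding G_def W_def by measurable
    have PG: "prob (G i) \<le> 1 - p" for i
    proof -
      have D: "distributed M lborel (\<lambda>\<omega>. B (u + r (Suc i)) \<omega> - B (u + r i) \<omega>)
          (normal_density 0 (sqrt (u + r (Suc i) - (u + r i))))"
        using u r_pos[of i] r_less[of i] by (intro normal_increments) auto
      have s: "sqrt (u + r (Suc i) - (u + r i)) > 0" using r_less[of i] by simp
      \<comment> \<open>The increment has variance at least \<open>r (Suc i) / 2\<close>, and 3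
        standard deviations suffice since 9/2 exceeds 4; hence the tail constant 3 in
        \<open>pP\<close>.\<close>
      have le: "2 * sqrt (r (Suc i)) \<le> 3 * sqrt (u + r (Suc i) - (u + r i))"
      proof -
        have "2 * r i \<le> r (Suc i)" using r_pos[of i] K2 by (simp add: r_Suc)
        then have "4 * r (Suc i) \<le> 9 * (u + r (Suc i) - (u + r i))" using r_pos[of i] by simp
        then have "sqrt (4 * r (Suc i)) \<le> sqrt (9 * (u + r (Suc i) - (u + r i)))" by simp
        then show ?thesis unfolding real_sqrt_mult by simp
      qed
      have "p \<le> prob {\<omega> \<in> space M. B (u + r (Suc i)) \<omega> - B (u + r i) \<omega> \<le> - 3 * sqrt (u + r (Suc i) - (u + r i))}"
        by (rule pP[OF s D])
      also have "\<dots> \<le> prob (space M - G i)"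
        using le by (intro finite_measure_mono) (auto simp: G_def)
      finally show ?thesis by (simp add: prob_compl)
    qed
    have PW: "prob (W i) \<le> 4 / K" for i
    proof -
      have D: "distributed M lborel (\<lambda>\<omega>. B (u + r i) \<omega> - B u \<omega>)
          (normal_density 0 (sqrt (u + r i - u)))"
        using u r_pos[of i] by (intro normal_increments) auto
      have "prob (W i) \<le> (sqrt (u + r i - u))\<^sup>2 / (sqrt (r (Suc i)) / 2)\<^sup>2"
        unfolding W_def using r_pos[of i] r_pos[of "Suc i"] by (intro normal_prob_abs_ge[OF D]) auto
      also have "\<dots> = 4 / K"
        using r_pos[of i] K2 by (simp add: power_divide r_Suc real_sqrt_mult power_mult_distrib)
      finally show ?thesis .
    qed
    \<comment> \<open>The product formula concerns nonempty index sets. For \<open>N = 0\<close> the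
      intersection is \<open>UNIV\<close>, so it is cut down to \<open>space M\<close>
      below.\<close>
    have PGall: "prob (\<Inter>i<N. G i) \<le> (1 - p) ^ N" if "N > 0"
    proof -
      have iv: "indep_vars (\<lambda>_. borel) (\<lambda>i \<omega>. B (u + r (Suc i)) \<omega> - B (u + r i) \<omega>) {..<N}"
        using u r_pos[of 0] r_less by (intro indep_increments) (auto intro: less_imp_le)
      have "indep_events (\<lambda>i. {x\<in>space M. - 2 * sqrt (r (Suc i)) < B (u + r (Suc i)) x - B (u + r i) x}) {..<N}"
        using indep_eventsI_indep_vars[OF iv, of "\<lambda>i y. - 2 * sqrt (r (Suc i)) < y"] by simp
      then have "indep_events G {..<N}"
        unfolding G_def[abs_def] .
      then have "prob (\<Inter>i<N. G i) = (\<Prod>i<N. prob (G i))"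
        using that unfolding indep_events_def by blast
      also have "\<dots> \<le> (\<Prod>i<N. 1 - p)" by (intro prod_mono) (auto simp: PG)
      finally show ?thesis by simp
    qed
    let ?E = "{\<omega> \<in> space M. \<forall>i<N. - sqrt a <
        B (u + a * K ^ Suc i) \<omega> - B u \<omega> + lam * (a * K ^ Suc i)}"
    \<comment> \<open>Off \<open>W i\<close>, the earlier path and the drift contribute at most
      \<open>sqrt (r (Suc i)) / 2\<close> each. An increment of at most
      \<open>- 2 * sqrt (r (Suc i))\<close> would thus bring the drifted path to
      \<open>- sqrt (r (Suc i))\<close> or lower, hence to \<open>- sqrt a\<close> or lower.\<close>
    have sub: "?E \<subseteq> (space M \<inter> (\<Inter>i<N. G i)) \<union> (\<Union>i<N. W i)"
    proof safe
      fix \<omega> i assume w: "\<omega> \<in> space M" and *: "\<forall>i<N. - sqrt a <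
        B (u + a * K ^ Suc i) \<omega> - B u \<omega> + lam * (a * K ^ Suc i)"
        and nW: "\<omega> \<notin> (\<Union>i<N. W i)" and i: "i < N"
      have **: "- sqrt a < B (u + r (Suc i)) \<omega> - B u \<omega> + lam * r (Suc i)"
        using *[rule_format, OF i] by (simp add: r_def)
      have "\<omega> \<notin> W i" using nW i by auto
      then have "\<bar>B (u + r i) \<omega> - B u \<omega>\<bar> < sqrt (r (Suc i)) / 2" using w by (simp add: W_def)
      moreover have "lam * r (Suc i) \<le> sqrt (r (Suc i)) / 2" using i by (intro drift) simp
      moreover have "sqrt a \<le> sqrt (r (Suc i))" using r_ge by simp
      ultimately have "- 2 * sqrt (r (Suc i)) < B (u + r (Suc i)) \<omega> - B (u + r i) \<omega>"
        using ** by linarith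
      then show "\<omega> \<in> G i" using w by (simp add: G_def)
    qed
    have GI: "space M \<inter> (\<Inter>i<N. G i) \<in> events"
      by (cases "N = 0") (auto intro!: sets.Int sets.finite_INT)
    have "prob ?E \<le> prob ((space M \<inter> (\<Inter>i<N. G i)) \<union> (\<Union>i<N. W i))"
      using sub by (intro finite_measure_mono) (auto intro: GI)
    also have "\<dots> \<le> prob (space M \<inter> (\<Inter>i<N. G i)) + prob (\<Union>i<N. W i)"
      by (intro measure_Un_le) (auto intro: GI)
    also have "prob (\<Union>i<N. W i) \<le> (\<Sum>i<N. prob (W i))"
      by (intro finite_measure_subadditive_finite) auto
    also have "\<dots> \<le> (\<Sum>i<N. 4 / K)" by (intro sum_mono PW)
    also have "\<dots> \<le> \<epsilon> / 2" using K by simp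
    also have "prob (space M \<inter> (\<Inter>i<N. G i)) \<le> (1 - p) ^ N"
    proof (cases "N = 0")
      case False
      then have "space M \<inter> (\<Inter>i<N. G i) = (\<Inter>i<N. G i)" by (auto simp: G_def)
      then show ?thesis using PGall False by simp
    qed simp
    finally show "prob ?E \<le> \<epsilon>" using N by simp
  qed (use a K2 in auto)
qed

end

section \<open>Independence of past and future\<close>

text \<open>The past of \<open>X\<close> up to time \<open>u\<close> without completion. Its
  generators are exact events, on which independence of the future is checked; null sets are left to
  almost-everywhere statements.\<close>

definition natural_sets :: "'a measure \<Rightarrow> (real \<Rightarrow> 'a \<Rightarrow> real) \<Rightarrow> real \<Rightarrow> 'a set set" where
  "natural_sets M X u =
    sigma_sets (space M) {X s -` A \<inter> space M | s A. 0 \<le> s \<and> s \<le> u \<and> A \<in> sets borel}"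

context standard_brownian_motion
begin

text \<open>Independence is given for the increments along one chain of times. The times of
  \<open>J\<close> and those of \<open>v\<close> are therefore merged into one chain through
  \<open>u\<close>: almost surely \<open>B s\<close> is a sum of increments before \<open>u\<close>,
  while \<open>E\<close> depends on those after \<open>u\<close>.\<close>

lemma indep_cylinder_future:
  fixes v :: "nat \<Rightarrow> real"
  assumes u: "0 \<le> u" and v0: "v 0 = u" and v_mono: "\<And>i. i < N \<Longrightarrow> v i \<le> v (Suc i)"
    and J: "finite J" "J \<subseteq> {0..u}" and A: "\<And>s. A s \<in> sets borel"
    and Q: "Measurable.pred (\<Pi>\<^sub>M i\<in>{..<N}. borel) Q"
  defines "E \<equiv> {\<omega> \<in> space M. Q (\<lambda>i\<in>{..<N}. B (v (Suc i)) \<omega> - B (v i) \<omega>)}"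
  shows "prob ({\<omega> \<in> space M. \<forall>s\<in>J. B s \<omega> \<in> A s} \<inter> E) =
    prob {\<omega> \<in> space M. \<forall>s\<in>J. B s \<omega> \<in> A s} * prob E"
proof -
  \<comment> \<open>Adding 0 and \<open>u\<close> makes the chain start at 0, where the path
    vanishes almost surely, and end at \<open>u = v 0\<close>, where the future times take
    over.\<close>
  define l where "l = sorted_list_of_set (insert 0 (insert u J))"
  have set_l: "set l = insert 0 (insert u J)" and l: "sorted l" "distinct l"
    using J by (auto simp: l_def simp del: sorted_list_of_set_insert_remove)
  define m where "m = length l - 1"
  have len: "length l = Suc m"
    using set_l by (cases l) (auto simp: m_def)
  have l_mono: "i \<le> j \<Longrightarrow> j \<le> m \<Longrightarrow> l ! i \<le> l ! j" for i j
    using l len by (auto intro: sorted_nth_mono)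
  have idx: "\<exists>i\<le>m. l ! i = s" if "s \<in> set l" for s
    using that len by (auto simp: in_set_conv_nth less_Suc_eq_le)
  have l_in: "l ! i \<in> {0..u}" if "i \<le> m" for i
    using nth_mem[of i l] that len J u unfolding set_l by auto
  have l0: "l ! 0 = 0"
    using idx[of 0] l_mono[of 0] l_in[of 0] set_l by fastforce
  have lm: "l ! m = u"
    using idx[of u] l_mono[of _ m] l_in[of m] set_l by fastforce
  from idx set_l have "\<forall>s\<in>J. \<exists>i\<le>m. l ! i = s" by auto
  then obtain k where k: "\<And>s. s \<in> J \<Longrightarrow> k s \<le> m \<and> l ! k s = s" by metis
  \<comment> \<open>Both branches agree at the junction: \<open>l ! m = u = v 0\<close>.\<close>
  define \<tau> where "\<tau> i = (if i \<le> m then l ! i else v (i - m))" for i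
  define D where "D i \<omega> = B (\<tau> (Suc i)) \<omega> - B (\<tau> i) \<omega>" for i \<omega>
  have \<tau>0: "\<tau> 0 = 0" and \<tau>v: "\<tau> (m + i) = v i" for i
    using l0 lm v0 by (auto simp: \<tau>_def)
  have \<tau>_mono: "\<tau> i \<le> \<tau> (Suc i)" if "i < m + N" for i
  proof (cases "i < m")
    case True
    then show ?thesis using l_mono[of i "Suc i"] by (simp add: \<tau>_def)
  next
    case False
    then obtain j where "i = m + j" by (auto simp: not_less le_iff_add)
    then show ?thesis using \<tau>v[of j] \<tau>v[of "Suc j"] v_mono[of j] that by simp
  qed
  have iv: "indep_vars (\<lambda>_. borel) D {..<m + N}"
    unfolding D_def[abs_def] using \<tau>0 \<tau>_mono by (intro indep_increments) auto
  have iv2: "indep_var (\<Pi>\<^sub>M i\<in>{..<m}. borel) (\<lambda>\<omega>. \<lambda>i\<in>{..<m}. D i \<omega>)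
      (\<Pi>\<^sub>M i\<in>{m..<m + N}. borel) (\<lambda>\<omega>. \<lambda>i\<in>{m..<m + N}. D i \<omega>)"
    by (rule indep_var_restrict[OF iv]) auto
  \<comment> \<open>\<open>C1\<close> and \<open>C2\<close> express the two events through the
    increments before and after index \<open>m\<close>, ready for the independence of the two
    blocks.\<close>
  define C1 where "C1 = {f \<in> space (\<Pi>\<^sub>M i\<in>{..<m}. (borel :: real measure)). \<forall>s\<in>J. (\<Sum>j<k s. f j) \<in> A s}"
  define C2 where "C2 = {f \<in> space (\<Pi>\<^sub>M i\<in>{m..<m + N}. (borel :: real measure)). Q (\<lambda>i\<in>{..<N}. f (m + i))}"
  have C1: "C1 \<in> sets (\<Pi>\<^sub>M i\<in>{..<m}. borel)"
    unfolding C1_def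
  proof (rule sets.sets_Collect_finite_All[OF _ J(1)])
    fix s assume s: "s \<in> J"
    have "(\<lambda>f. \<Sum>j<k s. f j) \<in> borel_measurable (\<Pi>\<^sub>M i\<in>{..<m}. (borel :: real measure))"
      using k[OF s] by (intro borel_measurable_sum measurable_component_singleton) auto
    from measurable_sets[OF this A[of s]]
    show "{f \<in> space (\<Pi>\<^sub>M i\<in>{..<m}. (borel :: real measure)). (\<Sum>j<k s. f j) \<in> A s} \<in> sets (\<Pi>\<^sub>M i\<in>{..<m}. borel)"
      by (simp add: vimage_def Int_def conj_commute)
  qed
  have C2: "C2 \<in> sets (\<Pi>\<^sub>M i\<in>{m..<m + N}. borel)"
  proof -
    have "(\<lambda>f. \<lambda>i\<in>{..<N}. f (m + i)) \<in>
        measurable (\<Pi>\<^sub>M i\<in>{m..<m + N}. (borel :: real measure)) (\<Pi>\<^sub>M i\<in>{..<N}. borel)"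
      by (intro measurable_restrict measurable_component_singleton) auto
    from measurable_compose[OF this Q] show ?thesis unfolding C2_def by (simp add: pred_def)
  qed
  let ?H = "{\<omega> \<in> space M. \<forall>s\<in>J. B s \<omega> \<in> A s}"
  let ?X = "\<lambda>\<omega>. \<lambda>i\<in>{..<m}. D i \<omega>" and ?Y = "\<lambda>\<omega>. \<lambda>i\<in>{m..<m + N}. D i \<omega>"
  have YE: "?Y -` C2 \<inter> space M = E"
  proof -
    have "(\<lambda>i\<in>{..<N}. (\<lambda>i\<in>{m..<m + N}. D i \<omega>) (m + i)) = (\<lambda>i\<in>{..<N}. B (v (Suc i)) \<omega> - B (v i) \<omega>)" for \<omega>
      using \<tau>v \<tau>v[of "Suc i" for i] by (auto simp: D_def fun_eq_iff restrict_def)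
    then show ?thesis by (auto simp: C2_def E_def space_PiM)
  qed
  \<comment> \<open>The telescoping sum gives \<open>B s - B 0\<close>, so the two events agree only
    up to the null set where \<open>B 0\<close> is not 0.\<close>
  have XH: "AE \<omega> in M. \<omega> \<in> ?X -` C1 \<inter> space M \<longleftrightarrow> \<omega> \<in> ?H"
    using start_zero
  proof eventually_elim
    case (elim \<omega>)
    have "(\<Sum>j<k s. (\<lambda>i\<in>{..<m}. D i \<omega>) j) = B s \<omega>" if "s \<in> J" for s
    proof -
      have "(\<Sum>j<k s. (\<lambda>i\<in>{..<m}. D i \<omega>) j) = (\<Sum>j<k s. D j \<omega>)"
        using k[OF that] by (intro sum.cong) auto
      also have "\<dots> = B (\<tau> (k s)) \<omega> - B (\<tau> 0) \<omega>"
        unfolding D_def by (rule sum_lessThan_telescope)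
      finally show ?thesis using k[OF that] \<tau>0 elim by (simp add: \<tau>_def)
    qed
    then show ?case by (auto simp: C1_def space_PiM)
  qed
  have rv: "?X \<in> measurable M (\<Pi>\<^sub>M i\<in>{..<m}. borel)" "?Y \<in> measurable M (\<Pi>\<^sub>M i\<in>{m..<m + N}. borel)"
    using indep_var_rv1[OF iv2] indep_var_rv2[OF iv2] by auto
  have XS: "?X -` C1 \<inter> space M \<in> events" using measurable_sets[OF rv(1) C1] .
  have ES: "E \<in> events" using measurable_sets[OF rv(2) C2] by (simp add: YE)
  have HS: "?H \<in> events"
  proof (rule sets.sets_Collect_finite_All[OF _ J(1)])
    fix s assume s: "s \<in> J"
    then have "B s \<in> borel_measurable M" using J by (intro random_variable_B) auto
    from measurable_sets[OF this A[of s]] show "{\<omega> \<in> space M. B s \<omega> \<in> A s} \<in> events"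
      by (simp add: vimage_def Int_def conj_commute)
  qed
  have "prob (?H \<inter> E) = prob ((?X -` C1 \<inter> space M) \<inter> E)"
    using XH by (intro finite_measure_eq_AE) (auto intro: XS ES HS)
  also have "(?X -` C1 \<inter> space M) \<inter> E = (\<lambda>\<omega>. (?X \<omega>, ?Y \<omega>)) -` (C1 \<times> C2) \<inter> space M"
    by (subst YE[symmetric]) auto
  also have "prob \<dots> = prob (?X -` C1 \<inter> space M) * prob (?Y -` C2 \<inter> space M)"
    by (rule indep_varD[OF iv2 C1 C2])
  also have "prob (?X -` C1 \<inter> space M) = prob ?H"
    using XH by (intro finite_measure_eq_AE) (auto intro: XS HS)
  finally show ?thesis unfolding YE .
qed

lemma natural_sets_events: "H \<in> natural_sets M B u \<Longrightarrow> H \<in> events"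
proof -
  have "{B s -` A \<inter> space M | s A. 0 \<le> s \<and> s \<le> u \<and> A \<in> sets borel} \<subseteq> events"
    by (auto intro: measurable_sets[OF random_variable_B])
  then show "H \<in> natural_sets M B u \<Longrightarrow> H \<in> events"
    unfolding natural_sets_def using sets.sigma_sets_subset by blast
qed

text \<open>Dynkin's pi-lambda argument: the finite-dimensional cylinders are stable under
  intersection and generate the past, so their independence of the fixed event \<open>E\<close>
  extends to all of \<open>natural_sets M B u\<close>.\<close>

lemma indep_past_future:
  fixes v :: "nat \<Rightarrow> real"
  assumes u: "0 \<le> u" and v0: "v 0 = u" and v_mono: "\<And>i. i < N \<Longrightarrow> v i \<le> v (Suc i)"
    and H: "H \<in> natural_sets M B u"
    and Q: "Measurable.pred (\<Pi>\<^sub>M i\<in>{..<N}. borel) Q"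
  defines "E \<equiv> {\<omega> \<in> space M. Q (\<lambda>i\<in>{..<N}. B (v (Suc i)) \<omega> - B (v i) \<omega>)}"
  shows "prob (H \<inter> E) = prob H * prob E"
proof -
  define \<C> where "\<C> = {{\<omega> \<in> space M. \<forall>s\<in>J. B s \<omega> \<in> A s} | J A.
    finite J \<and> J \<subseteq> {0..u} \<and> (\<forall>s. A s \<in> sets (borel :: real measure))}"
  have v_ge: "v i \<ge> u" if "i \<le> N" for i
    using that
  proof (induction i)
    case (Suc i)
    then show ?case using v_mono[of i] by simp
  qed (simp add: v0)
  have E: "E \<in> events"
  proof -
    have "(\<lambda>\<omega>. \<lambda>i\<in>{..<N}. B (v (Suc i)) \<omega> - B (v i) \<omega>) \<in> measurable M (\<Pi>\<^sub>M i\<in>{..<N}. borel)"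
    proof (intro measurable_restrict borel_measurable_diff random_variable_B)
      fix i assume "i \<in> {..<N}"
      then show "0 \<le> v (Suc i)" "0 \<le> v i" using v_ge[of i] v_ge[of "Suc i"] u by simp_all
    qed
    from measurable_compose[OF this Q] show ?thesis unfolding E_def by (simp add: pred_def)
  qed
  have \<C>: "\<C> \<subseteq> natural_sets M B u"
  proof
    fix C assume "C \<in> \<C>"
    then obtain J A where C: "C = {\<omega> \<in> space M. \<forall>s\<in>J. B s \<omega> \<in> A s}" and J: "finite J" "J \<subseteq> {0..u}"
      and A: "\<And>s. A s \<in> sets (borel :: real measure)" by (auto simp: \<C>_def)
    interpret S: sigma_algebra "space M" "natural_sets M B u"
      unfolding natural_sets_def by (rule sigma_algebra_sigma_sets) auto
    show "C \<in> natural_sets M B u"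
      unfolding C
    proof (rule S.sets_Collect_finite_All[OF _ J(1)])
      fix s assume "s \<in> J"
      then show "{\<omega> \<in> space M. B s \<omega> \<in> A s} \<in> natural_sets M B u"
        unfolding natural_sets_def using J A[of s]
        by (intro sigma_sets.Basic CollectI exI[of _ s] exI[of _ "A s"]) auto
    qed
  qed
  have "indep_set \<C> {E}"
  proof (rule indep_setI)
    show "\<C> \<subseteq> events" using \<C> natural_sets_events by blast
    fix C D assume "C \<in> \<C>" "D \<in> {E}"
    then obtain J A where "C = {\<omega> \<in> space M. \<forall>s\<in>J. B s \<omega> \<in> A s}" "finite J" "J \<subseteq> {0..u}"
      "\<And>s. A s \<in> sets (borel :: real measure)" "D = E" by (auto simp: \<C>_def)
    then show "prob (C \<inter> D) = prob C * prob D"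
      unfolding E_def using indep_cylinder_future[OF u v0 v_mono _ _ _ Q] by simp
  qed (simp add: E)
  moreover have "Int_stable \<C>"
  proof (rule Int_stableI)
    fix C C' assume "C \<in> \<C>" "C' \<in> \<C>"
    then obtain J A J' A' where C: "C = {\<omega> \<in> space M. \<forall>s\<in>J. B s \<omega> \<in> A s}" "finite J" "J \<subseteq> {0..u}"
      "\<And>s. A s \<in> sets (borel :: real measure)"
      and C': "C' = {\<omega> \<in> space M. \<forall>s\<in>J'. B s \<omega> \<in> A' s}" "finite J'" "J' \<subseteq> {0..u}"
      "\<And>s. A' s \<in> sets (borel :: real measure)" by (auto simp: \<C>_def)
    \<comment> \<open>Padding with \<open>UNIV\<close> turns both cylinders into cylinders over
      \<open>J \<union> J'\<close>.\<close>
    define A'' where "A'' s = (if s \<in> J then A s else UNIV) \<inter> (if s \<in> J' then A' s else UNIV)" for s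
    have "C \<inter> C' = {\<omega> \<in> space M. \<forall>s\<in>J \<union> J'. B s \<omega> \<in> A'' s}"
      unfolding C(1) C'(1) A''_def by auto
    moreover have "A'' s \<in> sets borel" for s using C(4) C'(4) by (auto simp: A''_def)
    ultimately show "C \<inter> C' \<in> \<C>"
      unfolding \<C>_def using C(2,3) C'(2,3)
      by (intro CollectI exI[of _ "J \<union> J'"] exI[of _ A'']) auto
  qed
  moreover have "Int_stable {E}" by (simp add: Int_stable_def)
  ultimately have ind: "indep_set (sigma_sets (space M) \<C>) (sigma_sets (space M) {E})"
    by (rule indep_set_sigma_sets)
  have "natural_sets M B u \<subseteq> sigma_sets (space M) \<C>"
    unfolding natural_sets_def
  proof (rule sigma_sets_mono, safe)
    fix s A assume s: "0 \<le> s" "s \<le> u" "A \<in> sets (borel :: real measure)"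
    have "B s -` A \<inter> space M \<in> \<C>"
      unfolding \<C>_def using s by (intro CollectI exI[of _ "{s}"] exI[of _ "\<lambda>_. A"]) auto
    then show "B s -` A \<inter> space M \<in> sigma_sets (space M) \<C>" by (rule sigma_sets.Basic)
  qed
  with H have "H \<in> sigma_sets (space M) \<C>" by blast
  then show ?thesis by (intro indep_setD[OF ind]) (auto intro: sigma_sets.Basic)
qed

end

section \<open>Optional times are not strict minima of the future\<close>

lemma natural_sets_mono: "u \<le> u' \<Longrightarrow> natural_sets M X u \<subseteq> natural_sets M X u'"
  unfolding natural_sets_def by (rule sigma_sets_mono') force

lemma sigma_algebra_natural_sets: "sigma_algebra (space M) (natural_sets M X u)"
  unfolding natural_sets_def by (rule sigma_algebra_sigma_sets) auto

context standard_brownian_motion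
begin

text \<open>The countably many stopping times approximating \<open>T\<close> from above reduce the strong Markov
  property to the independence of past and future at a fixed time.\<close>

lemma not_strict_future_minimum:
  fixes T :: "'a \<Rightarrow> real" and lam :: real
  assumes lam: "0 < lam" and E: "\<And>u. 0 < u \<Longrightarrow> E u \<in> natural_sets M B u"
    and P: "AE \<omega> in M. P \<omega> \<longrightarrow> 0 \<le> T \<omega> \<and> continuous_on {0..} (\<lambda>t. B t \<omega>) \<and>
      (\<forall>u>0. \<omega> \<in> E u \<longleftrightarrow> T \<omega> < u) \<and> (\<forall>t>T \<omega>. drifted B lam (T \<omega>) \<omega> < drifted B lam t \<omega>)"
  shows "AE \<omega> in M. \<not> P \<omega>"
proof -
  \<comment> \<open>\<open>P\<close> is an arbitrary predicate, so it is covered by measurable sets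
    of arbitrarily small probability.\<close>
  have "\<exists>L\<in>events. prob L \<le> \<epsilon> \<and> (AE \<omega> in M. P \<omega> \<longrightarrow> \<omega> \<in> L)" if "0 < \<epsilon>" for \<epsilon> :: real
  proof -
    obtain a K :: real and N :: nat where a: "0 < a" and K: "1 < K" and osc:
      "\<And>u. 0 \<le> u \<Longrightarrow> prob {\<omega> \<in> space M. \<forall>i<N. - sqrt a <
          B (u + a * K ^ Suc i) \<omega> - B u \<omega> + lam * (a * K ^ Suc i)} \<le> \<epsilon>"
      by (rule finite_oscillation[OF lam \<open>0 < \<epsilon>\<close>]) (rule that)
    \<comment> \<open>The grid of mesh \<open>1 / (k + 1)\<close>. It starts at
      \<open>1 / (k + 1)\<close>, since \<open>E\<close> describes \<open>T\<close> only at positive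
      times.\<close>
    define u where "u k j = real (Suc j) / real (Suc k)" for k j :: nat
    have u_pos: "0 < u k j" for k j by (simp add: u_def)
    \<comment> \<open>\<open>u k j\<close> is the first point of the \<open>k\<close>-th grid after
      \<open>T\<close>; this is known at time \<open>u k j\<close>. \<open>F k j\<close> says that
      the path then makes no drop of size \<open>sqrt a\<close> at the test times.\<close>
    define H where "H k j = E (u k j) - (\<Union>i<j. E (u k i))" for k j
    define F where "F k j = {\<omega> \<in> space M. \<forall>i<N. - sqrt a <
          B (u k j + a * K ^ Suc i) \<omega> - B (u k j) \<omega> + lam * (a * K ^ Suc i)}" for k j
    have H_nat: "H k j \<in> natural_sets M B (u k j)" for k j
    proof -
      interpret S: sigma_algebra "space M" "natural_sets M B (u k j)"
        by (rule sigma_algebra_natural_sets)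
      have "E (u k i) \<in> natural_sets M B (u k j)" if "i < j" for i
      proof -
        have "u k i \<le> u k j" using that by (simp add: u_def divide_right_mono)
        then show ?thesis using E[OF u_pos] natural_sets_mono by blast
      qed
      then show ?thesis unfolding H_def by (intro S.Diff S.finite_UN E u_pos) auto
    qed
    have H_ev[measurable]: "H k j \<in> events" for k j using natural_sets_events[OF H_nat] .
    have F_ev[measurable]: "F k j \<in> events" for k j
    proof -
      have [measurable]: "B (u k j + a * K ^ Suc i) \<in> borel_measurable M" "B (u k j) \<in> borel_measurable M" for i
        using u_pos[of k j] a K by (auto intro!: random_variable_B)
      show ?thesis unfolding F_def by measurable
    qed
    have HF: "prob (H k j \<inter> F k j) \<le> prob (H k j) * \<epsilon>" for k j
    proof -
      \<comment> \<open>The case \<open>i = 0\<close> is separate because \<open>a * K ^ 0\<close>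
        is \<open>a\<close>, whereas the chain has to start at \<open>u k j\<close> itself.\<close>
      define v where "v i = (if i = 0 then u k j else u k j + a * K ^ i)" for i
      define Q where "Q f \<longleftrightarrow> (\<forall>i<N. - sqrt a < (\<Sum>l\<le>i. f l) + lam * (a * K ^ Suc i))" for f :: "nat \<Rightarrow> real"
      have "Measurable.pred (\<Pi>\<^sub>M i\<in>{..<N}. borel) (\<lambda>f. \<forall>i\<in>{..<N}. - sqrt a < (\<Sum>l\<le>i. f l) + lam * (a * K ^ Suc i))"
      proof (rule pred_intros_finite)
        fix i assume "i \<in> {..<N}"
        then have [measurable]: "(\<lambda>f. \<Sum>l\<le>i. f l) \<in> borel_measurable (\<Pi>\<^sub>M i\<in>{..<N}. (borel :: real measure))"
          by (intro borel_measurable_sum measurable_component_singleton) auto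
        show "Measurable.pred (\<Pi>\<^sub>M i\<in>{..<N}. borel) (\<lambda>f. - sqrt a < (\<Sum>l\<le>i. f l) + lam * (a * K ^ Suc i))"
          by measurable
      qed simp
      then have Q: "Measurable.pred (\<Pi>\<^sub>M i\<in>{..<N}. borel) Q"
        unfolding Q_def[abs_def] by (simp add: Ball_def)
      have "Q (\<lambda>i\<in>{..<N}. B (v (Suc i)) \<omega> - B (v i) \<omega>) \<longleftrightarrow> (\<forall>i<N. - sqrt a <
          B (u k j + a * K ^ Suc i) \<omega> - B (u k j) \<omega> + lam * (a * K ^ Suc i))" for \<omega>
      proof -
        have "(\<Sum>l\<le>i. (\<lambda>i\<in>{..<N}. B (v (Suc i)) \<omega> - B (v i) \<omega>) l) =
            B (u k j + a * K ^ Suc i) \<omega> - B (u k j) \<omega>" if "i < N" for i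
        proof -
          have "(\<Sum>l\<le>i. (\<lambda>i\<in>{..<N}. B (v (Suc i)) \<omega> - B (v i) \<omega>) l) = (\<Sum>l<Suc i. B (v (Suc l)) \<omega> - B (v l) \<omega>)"
            using that by (intro sum.cong) auto
          also have "\<dots> = B (v (Suc i)) \<omega> - B (v 0) \<omega>" by (rule sum_lessThan_telescope)
          finally show ?thesis by (simp add: v_def)
        qed
        then show ?thesis by (auto simp: Q_def)
      qed
      then have F: "F k j = {\<omega> \<in> space M. Q (\<lambda>i\<in>{..<N}. B (v (Suc i)) \<omega> - B (v i) \<omega>)}"
        unfolding F_def by simp
      have "v i \<le> v (Suc i)" for i
        using a K power_increasing[of i "Suc i" K] by (auto simp: v_def simp del: power_Suc)
      then have "prob (H k j \<inter> F k j) = prob (H k j) * prob (F k j)"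
        unfolding F using u_pos[of k j] H_nat Q
        by (intro indep_past_future[where u="u k j" and v=v]) (auto simp: v_def)
      also have "prob (F k j) \<le> \<epsilon>"
        unfolding F_def using u_pos[of k j] by (intro osc) simp
      finally show ?thesis by (simp add: mult_left_mono)
    qed
    \<comment> \<open>The discretised time is followed by no drop. As the \<open>H k j\<close> are
      disjoint in \<open>j\<close>, summing the conditional bounds keeps the factor
      \<open>\<epsilon>\<close>.\<close>
    define V where "V k = (\<Union>j. H k j \<inter> F k j)" for k
    have V_ev[measurable]: "V k \<in> events" for k unfolding V_def by measurable
    have disj: "disjoint_family (H k)" for k
      unfolding disjoint_family_on_def H_def
    proof safe
      fix i j x assume "i \<noteq> j" "x \<in> E (u k i)" "x \<notin> (\<Union>l<i. E (u k l))" "x \<in> E (u k j)" "x \<notin> (\<Union>l<j. E (u k l))"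
      then show "x \<in> {}" by (cases "i < j") auto
    qed
    have PV: "prob (V k) \<le> \<epsilon>" for k
    proof -
      have "(\<lambda>j. prob (H k j \<inter> F k j)) sums prob (V k)"
        unfolding V_def using disj[of k] by (intro finite_measure_UNION) (auto simp: disjoint_family_on_def)
      moreover have "(\<lambda>j. prob (H k j) * \<epsilon>) sums (prob (\<Union>j. H k j) * \<epsilon>)"
        using disj[of k] by (intro sums_mult2 finite_measure_UNION) auto
      ultimately have "prob (V k) \<le> prob (\<Union>j. H k j) * \<epsilon>"
        using HF by (rule sums_le[rotated])
      also have "\<dots> \<le> 1 * \<epsilon>" using \<open>0 < \<epsilon>\<close> by (intro mult_right_mono) auto
      finally show ?thesis by simp
    qed
    \<comment> \<open>The union of the \<open>W n\<close> is the lower limit of the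
      \<open>V k\<close>: how fine the grid has to be depends on the path, but the bound
      \<open>\<epsilon>\<close> survives the increasing limit.\<close>
    define W where "W n = (\<Inter>k\<in>{n..}. V k)" for n
    have W_ev: "W n \<in> events" for n unfolding W_def by (intro sets.countable_INT') auto
    have PW: "prob (W n) \<le> \<epsilon>" for n
      using finite_measure_mono[OF _ V_ev[of n], of "W n"] PV[of n] by (force simp: W_def)
    have "incseq W" unfolding W_def incseq_def by force
    then have "(\<lambda>n. prob (W n)) \<longlonglongrightarrow> prob (\<Union>n. W n)"
      using W_ev by (intro finite_Lim_measure_incseq) auto
    then have "prob (\<Union>n. W n) \<le> \<epsilon>" using PW by (intro LIMSEQ_le_const2) auto
    moreover have "AE \<omega> in M. P \<omega> \<longrightarrow> \<omega> \<in> (\<Union>n. W n)"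
      using P AE_space
    proof eventually_elim
      case (elim \<omega>)
      show ?case
      proof
        assume "P \<omega>"
        with elim have T: "0 \<le> T \<omega>" and cont: "continuous_on {0..} (\<lambda>t. B t \<omega>)"
          and ET: "\<And>u. 0 < u \<Longrightarrow> \<omega> \<in> E u \<longleftrightarrow> T \<omega> < u"
          and above: "\<And>t. t > T \<omega> \<Longrightarrow> drifted B lam (T \<omega>) \<omega> < drifted B lam t \<omega>"
          and sp: "\<omega> \<in> space M" by auto
        have "continuous_on {0..} (\<lambda>t. drifted B lam t \<omega>)"
          unfolding drifted_def using cont by (intro continuous_intros)
        then obtain d where d: "0 < d" and near: "\<And>t. 0 \<le> t \<Longrightarrow> dist t (T \<omega>) < d \<Longrightarrow>
            dist (drifted B lam t \<omega>) (drifted B lam (T \<omega>) \<omega>) < sqrt a"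
          using T a unfolding continuous_on_iff by (metis atLeast_iff real_sqrt_gt_zero)
        obtain n where n: "inverse (real (Suc n)) < d" using reals_Archimedean[OF d] by blast
        have "\<omega> \<in> V k" if "n \<le> k" for k
        proof -
          have k: "1 / real (Suc k) < d"
            using n that by (auto intro: le_less_trans[rotated] simp: inverse_eq_divide frac_le)
          \<comment> \<open>The floor yields the first grid point strictly after
            \<open>T \<omega>\<close>, at distance at most \<open>1 / (k + 1)\<close>.\<close>
          define j where "j = nat \<lfloor>T \<omega> * real (Suc k)\<rfloor>"
          have j: "real j \<le> T \<omega> * real (Suc k)" "T \<omega> * real (Suc k) < real (Suc j)"
            using T unfolding j_def by (auto simp: of_nat_nat floor_le_iff) linarith+
          have T_less: "T \<omega> < u k j" using j by (simp add: u_def field_simps)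
          have less_T: "u k j < T \<omega> + d"
          proof -
            have "u k j = real j / real (Suc k) + 1 / real (Suc k)" by (simp add: u_def field_simps)
            also have "real j / real (Suc k) \<le> T \<omega>" using j by (simp add: divide_le_eq)
            finally show ?thesis using k by simp
          qed
          have "\<not> T \<omega> < u k i" if "i < j" for i
          proof -
            have "real (Suc i) \<le> real j" using that by simp
            with j have "u k i \<le> T \<omega>" by (simp add: u_def divide_le_eq del: of_nat_Suc)
            then show ?thesis by simp
          qed
          then have "\<omega> \<in> H k j" using ET[OF u_pos] T_less by (auto simp: H_def)
          \<comment> \<open>At \<open>u k j\<close> the path is less than \<open>sqrt a\<close>
            above its value at \<open>T \<omega>\<close>, and afterwards it never falls below that
            value.\<close>
          moreover have "\<omega> \<in> F k j"
          proof -
            have "- sqrt a < B (u k j + a * K ^ Suc i) \<omega> - B (u k j) \<omega> + lam * (a * K ^ Suc i)" for i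
            proof -
              have "drifted B lam (T \<omega>) \<omega> < drifted B lam (u k j + a * K ^ Suc i) \<omega>"
              proof (rule above)
                have "0 < a * K ^ Suc i" using a K by simp
                then show "T \<omega> < u k j + a * K ^ Suc i" using T_less by linarith
              qed
              moreover have "drifted B lam (u k j) \<omega> < drifted B lam (T \<omega>) \<omega> + sqrt a"
                using near[of "u k j"] u_pos[of k j] T_less less_T by (auto simp: dist_real_def)
              ultimately show ?thesis by (simp add: drifted_def algebra_simps)
            qed
            then show ?thesis using sp by (simp add: F_def)
          qed
          ultimately show ?thesis by (auto simp: V_def)
        qed
        then show "\<omega> \<in> (\<Union>n. W n)" by (auto simp: W_def)
      qed
    qed
    ultimately show ?thesis using W_ev by (intro bexI[of _ "\<Union>n. W n"]) auto
  qed
  \<comment> \<open>Intersecting the covers for \<open>\<epsilon> = 1 / (m + 1)\<close> traps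
    \<open>P\<close> almost surely in one null set.\<close>
  then have "\<forall>m. \<exists>L\<in>events. prob L \<le> inverse (real (Suc m)) \<and> (AE \<omega> in M. P \<omega> \<longrightarrow> \<omega> \<in> L)"
    by simp
  then obtain L where L: "\<And>m. L m \<in> events" "\<And>m. prob (L m) \<le> inverse (real (Suc m))"
    and PL: "\<And>m. AE \<omega> in M. P \<omega> \<longrightarrow> \<omega> \<in> L m" by metis
  have "prob (\<Inter>m. L m) \<le> inverse (real (Suc m))" for m
  proof -
    have "prob (\<Inter>m. L m) \<le> prob (L m)" using L(1) by (intro finite_measure_mono) auto
    also note L(2)
    finally show ?thesis .
  qed
  then have "prob (\<Inter>m. L m) \<le> 0"
    by (intro LIMSEQ_le_const[OF LIMSEQ_inverse_real_of_nat]) auto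
  then have "(\<Inter>m. L m) \<in> null_sets M"
    using L(1) by (intro null_setsI) (auto simp: emeasure_eq_measure measure_le_0_iff)
  from AE_not_in[OF this] AE_all_countable[THEN iffD2, OF allI, OF PL]
  show ?thesis by eventually_elim auto
qed

end

section \<open>The last passage time and the stopped process\<close>

text \<open>The set of visits is closed by continuity, bounded since \<open>L < \<infinity>\<close>,
  and nonempty by the intermediate value theorem, so its supremum is attained. A later value at or
  below \<open>z\<close> would force a further visit, as the path exceeds \<open>z\<close> at
  arbitrarily late times.\<close>

lemma last_visit:
  fixes x :: "real \<Rightarrow> real"
  assumes cont: "continuous_on {0..} x" and x0: "x 0 < z" and unbounded: "\<And>m. \<exists>n\<ge>m. z < x (real n)"
    and L: "L = (SUP t \<in> {t. 0 < t \<and> x t = z}. ennreal t)" "L < \<infinity>"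
  shows "\<exists>s>0. L = ennreal s \<and> x s = z \<and> (\<forall>t>s. z < x t)"
proof -
  define V where "V = {t. 0 < t \<and> x t = z}"
  have L': "L = (SUP t\<in>V. ennreal t)" using L by (simp add: V_def)
  have V_le: "ennreal t \<le> L" if "t \<in> V" for t
    unfolding L' using that by (rule SUP_upper)
  have cross: "\<exists>t\<ge>a. x t = z" if "0 \<le> a" "x a \<le> z" for a
  proof -
    obtain n where n: "n \<ge> nat \<lceil>a\<rceil>" "z < x (real n)" using unbounded by blast
    then have "a \<le> real n" by linarith
    moreover have "continuous_on {a..real n} x" using that by (intro continuous_on_subset[OF cont]) auto
    ultimately show ?thesis using IVT'[of x a z "real n"] that n by force
  qed
  obtain e where e: "0 \<le> e" "L = ennreal e" using L(2) by (cases L) auto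
  \<comment> \<open>Since \<open>x 0 < z\<close>, the open condition \<open>0 < t\<close> may be
    replaced by a closed one, which gives compactness.\<close>
  have Ve: "V = {0..e} \<inter> x -` {z}"
  proof -
    have "t \<le> e" if "t \<in> V" for t using V_le[OF that] e by simp
    then show ?thesis using x0 by (auto simp: V_def less_le)
  qed
  have "closed ({0..e} \<inter> x -` {z})"
    by (intro continuous_closed_preimage continuous_on_subset[OF cont]) auto
  then have "compact V"
    unfolding Ve by (metis bounded_Int bounded_closed_interval compact_eq_bounded_closed)
  moreover obtain t0 where "0 \<le> t0" "x t0 = z" using cross[of 0] x0 by auto
  then have "V \<noteq> {}" using x0 by (auto simp: V_def less_le)
  ultimately obtain s where s: "s \<in> V" "\<And>t. t \<in> V \<Longrightarrow> t \<le> s"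
    using compact_attains_sup by metis
  have s': "0 < s" "x s = z" using s(1) by (auto simp: V_def)
  show ?thesis
  proof (intro exI[of _ s] conjI allI impI)
    show "L = ennreal s"
      unfolding L' using s by (intro antisym SUP_least SUP_upper ennreal_leI) auto
    fix t assume "s < t"
    show "z < x t"
    proof (rule ccontr)
      assume "\<not> z < x t"
      then obtain t' where "t' \<ge> t" "x t' = z" using cross[of t] s' \<open>s < t\<close> by auto
      then show False using s(2)[of t'] s' \<open>s < t\<close> by (auto simp: V_def)
    qed
  qed (use s' in auto)
qed

text \<open>Before \<open>T\<close> the stopped path is \<open>X\<close> itself, so generators agree
  on \<open>{q < T}\<close>, and null sets agree with the empty set up to a null set. Such agreement
  passes to complements and countable unions.\<close>

lemma stopped_trace:
  assumes q: "0 \<le> q" and C: "C \<in> sets (completed_natural_filtration M (stopped_process X T) (ennreal q))"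
  shows "\<exists>C'\<in>natural_sets M X q. AE \<omega> in M. ennreal q < T \<omega> \<longrightarrow> (\<omega> \<in> C \<longleftrightarrow> \<omega> \<in> C')"
proof -
  let ?\<xi> = "stopped_process X T"
  let ?G = "{?\<xi> s -` A \<inter> space M | s A. 0 \<le> s \<and> ennreal s \<le> ennreal q \<and> A \<in> sets borel} \<union> null_sets M"
  have "?G \<subseteq> Pow (space M)"
    using sets.sets_into_space by (fastforce simp: null_sets_def)
  with C have "C \<in> sigma_sets (space M) ?G"
    by (simp add: completed_natural_filtration_def)
  then show ?thesis
  proof (induction rule: sigma_sets.induct)
    case (Basic C)
    then consider s A where "C = ?\<xi> s -` A \<inter> space M" "0 \<le> s" "ennreal s \<le> ennreal q" "A \<in> sets borel"
      | "C \<in> null_sets M" by blast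
    then show ?case
    proof cases
      case 1
      have "s \<le> q" using 1 q by simp
      show ?thesis
      proof (intro bexI AE_I2 impI)
        show "X s -` A \<inter> space M \<in> natural_sets M X q"
          unfolding natural_sets_def using 1 \<open>s \<le> q\<close> by (intro sigma_sets.Basic) blast
        fix \<omega> assume "ennreal q < T \<omega>"
        then have "min (ennreal s) (T \<omega>) = ennreal s" using 1(3) by (intro min_absorb1) simp
        then show "\<omega> \<in> C \<longleftrightarrow> \<omega> \<in> X s -` A \<inter> space M"
          using 1 by (simp add: stopped_process_def)
      qed
    next
      case 2
      have "AE \<omega> in M. ennreal q < T \<omega> \<longrightarrow> (\<omega> \<in> C \<longleftrightarrow> \<omega> \<in> {})"
        using AE_not_in[OF 2] by eventually_elim simp
      moreover have "{} \<in> natural_sets M X q"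
        unfolding natural_sets_def by (rule sigma_sets.Empty)
      ultimately show ?thesis by blast
    qed
  next
    case Empty
    show ?case by (intro bexI[of _ "{}"]) (auto simp: natural_sets_def sigma_sets.Empty)
  next
    case (Compl C)
    then obtain C' where C': "C' \<in> natural_sets M X q"
      and ae: "AE \<omega> in M. ennreal q < T \<omega> \<longrightarrow> (\<omega> \<in> C \<longleftrightarrow> \<omega> \<in> C')" by blast
    from ae have "AE \<omega> in M. ennreal q < T \<omega> \<longrightarrow> (\<omega> \<in> space M - C \<longleftrightarrow> \<omega> \<in> space M - C')"
      by eventually_elim auto
    moreover have "space M - C' \<in> natural_sets M X q"
      using C' unfolding natural_sets_def by (rule sigma_sets.Compl)
    ultimately show ?case by blast
  next
    case (Union C)
    then have "\<forall>i. \<exists>C'\<in>natural_sets M X q. AE \<omega> in M. ennreal q < T \<omega> \<longrightarrow> (\<omega> \<in> C i \<longleftrightarrow> \<omega> \<in> C')"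
      by blast
    then obtain C' where C': "\<And>i. C' i \<in> natural_sets M X q"
      and ae: "\<And>i. AE \<omega> in M. ennreal q < T \<omega> \<longrightarrow> (\<omega> \<in> C i \<longleftrightarrow> \<omega> \<in> C' i)" by metis
    have "AE \<omega> in M. \<forall>i. ennreal q < T \<omega> \<longrightarrow> (\<omega> \<in> C i \<longleftrightarrow> \<omega> \<in> C' i)"
      by (subst AE_all_countable) (rule allI, rule ae)
    then have "AE \<omega> in M. ennreal q < T \<omega> \<longrightarrow> (\<omega> \<in> (\<Union>i. C i) \<longleftrightarrow> \<omega> \<in> (\<Union>i. C' i))"
      by eventually_elim auto
    moreover have "(\<Union>i. C' i) \<in> natural_sets M X q"
      using C' unfolding natural_sets_def by (rule sigma_sets.Union)
    ultimately show ?case by blast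
  qed
qed

lemma natural_sets_drifted: "natural_sets M (drifted B lam) u \<subseteq> natural_sets M B u"
  unfolding natural_sets_def
proof (rule sigma_sets_mono', safe)
  fix s and A :: "real set" assume s: "0 \<le> s" "s \<le> u" and A: "A \<in> sets borel"
  have "(\<lambda>x. x + lam * s) -` A \<inter> space borel \<in> sets borel"
    using A by (rule measurable_sets[rotated]) simp
  moreover have "drifted B lam s -` A \<inter> space M = B s -` ((\<lambda>x. x + lam * s) -` A \<inter> space borel) \<inter> space M"
    by (auto simp: drifted_def)
  ultimately show "\<exists>s' A'. drifted B lam s -` A \<inter> space M = B s' -` A' \<inter> space M \<and>
      0 \<le> s' \<and> s' \<le> u \<and> A' \<in> sets borel"
    using s by blast
qed

section \<open>Completeness: measurability up to null sets\<close>

lemma (in complete_measure) null_sets_AE: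
  assumes "AE \<omega> in M. \<omega> \<notin> A" "A \<subseteq> space M"
  shows "A \<in> null_sets M"
proof -
  obtain N where N: "{\<omega> \<in> space M. \<not> \<omega> \<notin> A} \<subseteq> N" "emeasure M N = 0" "N \<in> sets M"
    using assms(1) by (rule AE_E)
  then have "A \<subseteq> N" "N \<in> null_sets M" using assms(2) by auto
  then show ?thesis using complete null_sets_subset by blast
qed

text \<open>By completeness \<open>A - C\<close> and \<open>C - A\<close> are null sets, and these
  belong to the completed filtration at every time; \<open>A\<close> is \<open>C\<close> corrected
  by them.\<close>

lemma (in complete_measure) sets_completed_natural_filtration_AE:
  assumes C: "C \<in> sets (completed_natural_filtration M X t)" and A: "A \<subseteq> space M"
    and ae: "AE \<omega> in M. \<omega> \<in> A \<longleftrightarrow> \<omega> \<in> C"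
  shows "A \<in> sets (completed_natural_filtration M X t)"
proof -
  have sub: "{X s -` A \<inter> space M | s A. 0 \<le> s \<and> ennreal s \<le> t \<and> A \<in> sets borel} \<union> null_sets M
      \<subseteq> Pow (space M)"
    using sets.sets_into_space by (fastforce simp: null_sets_def)
  have null: "N \<in> sets (completed_natural_filtration M X t)" if "N \<in> null_sets M" for N
    using that by (simp add: completed_natural_filtration_def sets_measure_of[OF sub] sigma_sets.Basic)
  have "C \<subseteq> space M"
    using sets.sets_into_space[OF C] by (simp add: completed_natural_filtration_def space_measure_of[OF sub])
  have "A - C \<in> null_sets M" "C - A \<in> null_sets M"
    using ae A \<open>C \<subseteq> space M\<close> by (auto intro!: null_sets_AE elim!: eventually_mono)
  then have "(C - (C - A)) \<union> (A - C) \<in> sets (completed_natural_filtration M X t)"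
    by (intro sets.Un sets.Diff C null)
  moreover have "(C - (C - A)) \<union> (A - C) = A" by auto
  ultimately show ?thesis by simp
qed

section \<open>The last passage time of Brownian motion with drift\<close>

context standard_brownian_motion
begin

lemma drifted_AE_neq:
  assumes "0 \<le> t" "z \<noteq> 0"
  shows "AE \<omega> in M. drifted B lam t \<omega> \<noteq> z"
proof (cases "t = 0")
  case True
  from start_zero show ?thesis by eventually_elim (use assms True in \<open>simp add: drifted_def\<close>)
next
  case False
  have "AE \<omega> in M. B t \<omega> - B 0 \<omega> \<noteq> z - lam * t"
    using assms False by (intro normal_prob_atom[OF normal_increments]) auto
  with start_zero show ?thesis by eventually_elim (auto simp: drifted_def)
qed

text \<open>Staying at or below \<open>z\<close> from \<open>m\<close> on forces the centred
  increment over \<open>[0, n]\<close> to have size at least \<open>lam * n / 2\<close> for every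
  large \<open>n\<close>; by Chebyshev this has probability at most
  \<open>4 / (lam\<^sup>2 * n)\<close>. Integer times keep the event measurable.\<close>

lemma drifted_unbounded:
  assumes lam: "0 < lam"
  shows "AE \<omega> in M. \<forall>m. \<exists>n\<ge>m. z < drifted B lam (real n) \<omega>"
proof -
  have "AE \<omega> in M. \<exists>n\<ge>m. z < B (real n) \<omega> - B 0 \<omega> + lam * real n" for m
  proof -
    define A where "A = {\<omega> \<in> space M. \<forall>n\<ge>m. B (real n) \<omega> - B 0 \<omega> + lam * real n \<le> z}"
    have [measurable]: "B (real n) \<in> borel_measurable M" "B 0 \<in> borel_measurable M" for n
      by (auto intro: random_variable_B)
    have [measurable]: "A \<in> events" unfolding A_def by measurable
    \<comment> \<open>From here on \<open>\<bar>z\<bar> \<le> lam * n / 2\<close>; the final 1 makes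
      \<open>n\<close> positive.\<close>
    define n0 where "n0 = m + nat \<lceil>2 * \<bar>z\<bar> / lam\<rceil> + 1"
    have bound: "prob A \<le> (4 / lam\<^sup>2) * inverse (real n)" if n: "n \<ge> n0" for n
    proof -
      have n': "n \<ge> m" "real n > 0" using n by (auto simp: n0_def)
      have "2 * \<bar>z\<bar> / lam \<le> real n" using n unfolding n0_def by linarith
      then have z: "z \<le> lam * real n / 2" using lam by (simp add: field_simps)
      have "A \<subseteq> {\<omega> \<in> space M. lam * real n / 2 \<le> \<bar>B (real n) \<omega> - B 0 \<omega>\<bar>}"
      proof
        fix \<omega> assume "\<omega> \<in> A"
        then have "\<omega> \<in> space M" "B (real n) \<omega> - B 0 \<omega> + lam * real n \<le> z" using n' by (auto simp: A_def)
        moreover from this have "lam * real n / 2 \<le> - (B (real n) \<omega> - B 0 \<omega>)" using z by linarith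
        then have "lam * real n / 2 \<le> \<bar>B (real n) \<omega> - B 0 \<omega>\<bar>" by linarith
        ultimately show "\<omega> \<in> {\<omega> \<in> space M. lam * real n / 2 \<le> \<bar>B (real n) \<omega> - B 0 \<omega>\<bar>}" by simp
      qed
      then have "prob A \<le> prob {\<omega> \<in> space M. lam * real n / 2 \<le> \<bar>B (real n) \<omega> - B 0 \<omega>\<bar>}"
        by (intro finite_measure_mono) measurable
      also have "\<dots> \<le> (sqrt (real n - 0))\<^sup>2 / (lam * real n / 2)\<^sup>2"
        using n' lam by (intro normal_prob_abs_ge normal_increments) auto
      also have "\<dots> = (4 / lam\<^sup>2) * inverse (real n)"
        using n' lam by (simp add: field_simps power2_eq_square)
      finally show ?thesis .
    qed
    have "(\<lambda>n. (4 / lam\<^sup>2) * inverse (real n)) \<longlonglongrightarrow> (4 / lam\<^sup>2) * 0"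
      by (intro tendsto_mult tendsto_const tendsto_inverse_0_at_top filterlim_real_sequentially)
    then have "prob A \<le> (4 / lam\<^sup>2) * 0"
      using bound by (intro LIMSEQ_le_const) auto
    then have "A \<in> null_sets M"
      by (intro null_setsI) (auto simp: emeasure_eq_measure measure_le_0_iff)
    from AE_not_in[OF this] AE_space show ?thesis
      by eventually_elim (auto simp: A_def not_le)
  qed
  then have "AE \<omega> in M. \<forall>m. \<exists>n\<ge>m. z < B (real n) \<omega> - B 0 \<omega> + lam * real n"
    by (simp add: AE_all_countable)
  with start_zero show ?thesis by eventually_elim (simp add: drifted_def)
qed

text \<open>A pathwise application of \<open>last_visit\<close>. Finiteness is kept as a premise
  because the time is used only where it is bounded by, or equal to, a finite time.\<close>

lemma last_passage_AE:
  assumes lam: "0 < lam" and z: "0 < z"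
  shows "AE \<omega> in M. last_passage_time (drifted B lam) z \<omega> < \<infinity> \<longrightarrow>
    (\<exists>s>0. last_passage_time (drifted B lam) z \<omega> = ennreal s \<and> drifted B lam s \<omega> = z \<and>
      (\<forall>t>s. z < drifted B lam t \<omega>))"
  using start_zero continuous_paths drifted_unbounded[OF lam, of z]
proof eventually_elim
  case (elim \<omega>)
  have cont: "continuous_on {0..} (\<lambda>t. drifted B lam t \<omega>)"
    unfolding drifted_def using elim(2) by (intro continuous_intros)
  have start: "drifted B lam 0 \<omega> < z" using elim(1) z by (simp add: drifted_def)
  show ?case
    using last_visit[OF cont start elim(3)[rule_format]
      last_passage_time_def[of "drifted B lam" z \<omega>]] by blast
qed

lemma stopping_time_last_passage:
  assumes "complete_measure M" and lam: "0 < lam" and z: "0 < z"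
  shows "stopping_time (completed_natural_filtration M (last_passage_process B lam z))
    (last_passage_time (drifted B lam) z)"
proof
  fix t :: ennreal
  interpret complete_measure M by fact
  let ?T = "last_passage_time (drifted B lam) z" and ?\<xi> = "last_passage_process B lam z"
  let ?F = "completed_natural_filtration M ?\<xi>"
  interpret F: filtration "space M" ?F by (rule filtration_completed_natural_filtration)
  have "{\<omega> \<in> space M. ?T \<omega> \<le> t} \<in> sets (?F t)"
  proof (cases t)
    case top
    then show ?thesis using sets.top[of "?F t"] by (simp add: F.space_F)
  next
    case (real r)
    have meas: "?\<xi> r -` {z} \<inter> space M \<in> sets (?F t)"
    proof -
      have "{?\<xi> s -` A \<inter> space M | s A. 0 \<le> s \<and> ennreal s \<le> t \<and> A \<in> sets borel} \<union> null_sets M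
          \<subseteq> Pow (space M)"
        using sets.sets_into_space by (fastforce simp: null_sets_def)
      then show ?thesis
        unfolding completed_natural_filtration_def using real
        by (subst sets_measure_of) (auto intro!: sigma_sets.Basic exI[of _ r] exI[of _ "{z}"])
    qed
    \<comment> \<open>If the last visit is not after \<open>r\<close>, the stopped path rests at
      \<open>z\<close>. Otherwise it shows \<open>drifted B lam r\<close>, which differs from
      \<open>z\<close> almost surely since a normal law has no atoms.\<close>
    have ae: "AE \<omega> in M. \<omega> \<in> {\<omega> \<in> space M. ?T \<omega> \<le> t} \<longleftrightarrow> \<omega> \<in> ?\<xi> r -` {z} \<inter> space M"
      using last_passage_AE[OF lam z] drifted_AE_neq[OF real(1) less_imp_neq[OF z, symmetric], of lam] AE_space
    proof eventually_elim
      case (elim \<omega>)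
      show ?case
      proof (cases "?T \<omega> \<le> t")
        case True
        then have "?T \<omega> < \<infinity>" using real by (simp add: le_less_trans[OF True])
        with elim obtain s where "0 < s" "?T \<omega> = ennreal s" "drifted B lam s \<omega> = z" by blast
        with True real elim show ?thesis
          by (simp add: last_passage_process_def stopped_process_def min_absorb2)
      next
        case False
        then have "min (ennreal r) (?T \<omega>) = ennreal r" using real by (intro min_absorb1) simp
        with False real elim show ?thesis
          by (simp add: last_passage_process_def stopped_process_def)
      qed
    qed
    show ?thesis by (rule sets_completed_natural_filtration_AE[OF meas _ ae]) auto
  qed
  then show "Measurable.pred (?F t) (\<lambda>\<omega>. ?T \<omega> \<le> t)"
    by (simp add: pred_def F.space_F)
qed

text \<open>On the event in question every announcing time lies strictly before the last passage,
  where the past of \<open>B\<close> determines it. Their limit is thus described by events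
  \<open>E u\<close> of that past, so \<open>not_strict_future_minimum\<close> applies.\<close>

lemma last_passage_neq_predictable:
  assumes lam: "0 < lam" and z: "0 < z"
    and S: "predictable_stopping_time M (completed_natural_filtration M (last_passage_process B lam z)) S"
  shows "AE \<omega> in M. \<not> (last_passage_time (drifted B lam) z \<omega> = S \<omega> \<and> S \<omega> < \<infinity>)"
proof -
  let ?T = "last_passage_time (drifted B lam) z" and ?\<xi> = "last_passage_process B lam z"
  let ?F = "completed_natural_filtration M ?\<xi>"
  interpret F: filtration "space M" ?F by (rule filtration_completed_natural_filtration)
  obtain R where R: "\<And>n :: nat. stopping_time ?F (R n)" and announce: "AE \<omega> in M. incseq (\<lambda>n. R n \<omega>) \<and>
      (\<lambda>n. R n \<omega>) \<longlonglongrightarrow> S \<omega> \<and> (0 < S \<omega> \<longrightarrow> (\<forall>n. R n \<omega> < S \<omega>))"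
    using S unfolding predictable_stopping_time_def by blast
  have "\<exists>C\<in>natural_sets M B q. AE \<omega> in M. ennreal q < ?T \<omega> \<longrightarrow> (R n \<omega> \<le> ennreal q \<longleftrightarrow> \<omega> \<in> C)"
    if "0 \<le> q" for n and q :: real
  proof -
    have "{\<omega> \<in> space M. R n \<omega> \<le> ennreal q} \<in> sets (?F (ennreal q))"
      using stopping_timeD[OF R, of n "ennreal q"] by (simp add: pred_def F.space_F)
    then obtain C where C: "C \<in> natural_sets M (drifted B lam) q"
      and ae: "AE \<omega> in M. ennreal q < ?T \<omega> \<longrightarrow> (\<omega> \<in> {\<omega> \<in> space M. R n \<omega> \<le> ennreal q} \<longleftrightarrow> \<omega> \<in> C)"
      using stopped_trace[OF \<open>0 \<le> q\<close>] unfolding last_passage_process_def by blast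
    from ae AE_space have "AE \<omega> in M. ennreal q < ?T \<omega> \<longrightarrow> (R n \<omega> \<le> ennreal q \<longleftrightarrow> \<omega> \<in> C)"
      by eventually_elim simp
    with C natural_sets_drifted show ?thesis by blast
  qed
  then have "\<forall>n. \<forall>q\<in>{0..}. \<exists>C. C \<in> natural_sets M B q \<and>
      (AE \<omega> in M. ennreal q < ?T \<omega> \<longrightarrow> (R n \<omega> \<le> ennreal q \<longleftrightarrow> \<omega> \<in> C))"
    by (meson atLeast_iff)
  then obtain C where C_all: "\<forall>n. \<forall>q\<in>{0..}. C n q \<in> natural_sets M B q \<and>
      (AE \<omega> in M. ennreal q < ?T \<omega> \<longrightarrow> (R n \<omega> \<le> ennreal q \<longleftrightarrow> \<omega> \<in> C n q))"
    unfolding bchoice_iff choice_iff by (elim exE)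
  then have C: "C n q \<in> natural_sets M B q"
    and C_AE: "AE \<omega> in M. ennreal q < ?T \<omega> \<longrightarrow> (R n \<omega> \<le> ennreal q \<longleftrightarrow> \<omega> \<in> C n q)"
    if "0 \<le> q" for n q
    using that by auto
  \<comment> \<open>Restricting to rational \<open>q\<close> leaves one exceptional null set for all
    \<open>n\<close> and \<open>q\<close>.\<close>
  have trace: "AE \<omega> in M. \<forall>n. \<forall>q\<in>\<rat> \<inter> {0..}. ennreal q < ?T \<omega> \<longrightarrow> (R n \<omega> \<le> ennreal q \<longleftrightarrow> \<omega> \<in> C n q)"
  proof (subst AE_all_countable, rule allI)
    fix n
    show "AE \<omega> in M. \<forall>q\<in>\<rat> \<inter> {0..}. ennreal q < ?T \<omega> \<longrightarrow> (R n \<omega> \<le> ennreal q \<longleftrightarrow> \<omega> \<in> C n q)"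
      by (rule AE_ball_countable') (auto intro: C_AE countable_Int1 countable_rat)
  qed
  \<comment> \<open>Encodes that all \<open>R n\<close> are below a common \<open>v < u\<close>,
    hence that their limit is below \<open>u\<close>. The rational bound \<open>q < v\<close>
    matters because \<open>C n q\<close> is known to describe \<open>R n\<close> only for
    \<open>q\<close> before the last passage.\<close>
  define E where "E u = (\<Union>v\<in>\<rat> \<inter> {0..<u}. \<Inter>n. \<Union>q\<in>\<rat> \<inter> {0..<v}. C n q)" for u :: real
  have E: "E u \<in> natural_sets M B u" for u
  proof -
    interpret S: sigma_algebra "space M" "natural_sets M B u"
      by (rule sigma_algebra_natural_sets)
    have cnt: "countable (\<rat> \<inter> {0..<v :: real})" for v
      by (intro countable_Int1 countable_rat)
    have "C n q \<in> natural_sets M B u" if "0 \<le> q" "q < u" for n q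
      using C[OF that(1)] natural_sets_mono[of q u M B] that by auto
    then have "(\<Union>q\<in>\<rat> \<inter> {0..<v}. C n q) \<in> natural_sets M B u" if "v < u" for n v
      using that by (intro S.countable_UN'' cnt) auto
    then have "(\<Inter>n. \<Union>q\<in>\<rat> \<inter> {0..<v}. C n q) \<in> natural_sets M B u" if "v < u" for v
      using that by (intro S.countable_INT) auto
    then show ?thesis unfolding E_def by (intro S.countable_UN'' cnt) auto
  qed
  show ?thesis
  proof (rule not_strict_future_minimum[OF lam E, where T="\<lambda>\<omega>. enn2real (?T \<omega>)"])
    show "AE \<omega> in M. ?T \<omega> = S \<omega> \<and> S \<omega> < \<infinity> \<longrightarrow> 0 \<le> enn2real (?T \<omega>) \<and>
        continuous_on {0..} (\<lambda>t. B t \<omega>) \<and> (\<forall>u>0. (\<omega> \<in> E u) = (enn2real (?T \<omega>) < u)) \<and>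
        (\<forall>t>enn2real (?T \<omega>). drifted B lam (enn2real (?T \<omega>)) \<omega> < drifted B lam t \<omega>)"
      using announce trace continuous_paths last_passage_AE[OF lam z]
    proof eventually_elim
      case (elim \<omega>)
      show ?case
      proof
        assume "?T \<omega> = S \<omega> \<and> S \<omega> < \<infinity>"
        then obtain s where s: "0 < s" "?T \<omega> = ennreal s" "S \<omega> = ennreal s" "drifted B lam s \<omega> = z"
          "\<And>t. t > s \<Longrightarrow> z < drifted B lam t \<omega>"
          using elim(4) by auto
        have R_less: "R n \<omega> < ennreal s" for n using elim(1) s by simp
        have R_lim: "(\<lambda>n. R n \<omega>) \<longlonglongrightarrow> ennreal s" using elim(1) s by simp
        have trace': "R n \<omega> \<le> ennreal q \<longleftrightarrow> \<omega> \<in> C n q" if "q \<in> \<rat>" "0 \<le> q" "q < s" for n q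
          using elim(2) that s by (auto simp: ennreal_lessI)
        have "\<omega> \<in> E u \<longleftrightarrow> s < u" if "0 < u" for u
        proof
          assume "\<omega> \<in> E u"
          then obtain v where v: "0 \<le> v" "v < u" "\<And>n. \<exists>q\<in>\<rat> \<inter> {0..<v}. \<omega> \<in> C n q"
            by (auto simp: E_def)
          show "s < u"
          \<comment> \<open>Assuming \<open>u \<le> s\<close> places every \<open>q < v < u\<close>
            before the last passage, so \<open>C n q\<close> may be read as
            \<open>R n \<omega> \<le> ennreal q\<close>.\<close>
          proof (rule ccontr)
            assume "\<not> s < u"
            have "R n \<omega> \<le> ennreal v" for n
            proof -
              obtain q where q: "q \<in> \<rat>" "0 \<le> q" "q < v" "\<omega> \<in> C n q" using v(3)[of n] by auto
              then have "R n \<omega> \<le> ennreal q" using trace'[of q n] v \<open>\<not> s < u\<close> by simp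
              also have "\<dots> \<le> ennreal v" using q by (intro ennreal_leI) simp
              finally show ?thesis .
            qed
            then have "ennreal s \<le> ennreal v" by (intro LIMSEQ_le_const2[OF R_lim]) auto
            then show False using v \<open>\<not> s < u\<close> by simp
          qed
        next
          assume "s < u"
          then obtain v where v: "v \<in> \<rat>" "s < v" "v < u" using Rats_dense_in_real by blast
          have "\<exists>q\<in>\<rat> \<inter> {0..<v}. \<omega> \<in> C n q" for n
          proof -
            \<comment> \<open>Strict announcement leaves room for a rational \<open>q\<close>
              between \<open>R n \<omega>\<close> and \<open>s\<close>, where \<open>C n q\<close>
              is informative.\<close>
            obtain r where r: "0 \<le> r" "R n \<omega> = ennreal r" "r < s"
              using R_less[of n] by (cases "R n \<omega>") (auto simp: ennreal_less_iff)
            obtain q where q: "q \<in> \<rat>" "r < q" "q < s" using Rats_dense_in_real[OF r(3)] by blast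
            then have "R n \<omega> \<le> ennreal q" using r by (simp add: ennreal_leI)
            then have "\<omega> \<in> C n q" using trace'[of q n] q r by simp
            then show ?thesis using q r v by (intro bexI[of _ q]) auto
          qed
          then show "\<omega> \<in> E u"
            unfolding E_def using v s(1) by (intro UN_I[of v]) auto
        qed
        then show "0 \<le> enn2real (?T \<omega>) \<and>
          continuous_on {0..} (\<lambda>t. B t \<omega>) \<and> (\<forall>u>0. (\<omega> \<in> E u) = (enn2real (?T \<omega>) < u)) \<and>
          (\<forall>t>enn2real (?T \<omega>). drifted B lam (enn2real (?T \<omega>)) \<omega> < drifted B lam t \<omega>)"
          using s elim(3) by simp
      qed
    qed
  qed
qed

end

theorem corollary4p5:
  fixes M :: "'a measure" and B :: "real \<Rightarrow> 'a \<Rightarrow> real" and lam z :: real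
  assumes "complete_measure M"
    and "standard_brownian_motion M B"
    and "0 < lam" and "0 < z"
  shows "totally_inaccessible_stopping_time M
    (completed_natural_filtration M (last_passage_process B lam z))
    (last_passage_time (drifted B lam) z)"
proof -
  interpret standard_brownian_motion M B by fact
  interpret complete_measure M by fact
  show ?thesis
    unfolding totally_inaccessible_stopping_time_def
  \<comment> \<open>Completeness also supplies the measurability of the event for an arbitrary
    predictable \<open>S\<close>.\<close>
  proof (intro conjI allI impI null_sets_AE)
    show "stopping_time (completed_natural_filtration M (last_passage_process B lam z))
        (last_passage_time (drifted B lam) z)"
      by (rule stopping_time_last_passage) fact+
    fix S assume "predictable_stopping_time M (completed_natural_filtration M (last_passage_process B lam z)) S"
    from last_passage_neq_predictable[OF assms(3,4) this]
    show "AE \<omega> in M. \<omega> \<notin> {\<omega> \<in> space M. last_passage_time (drifted B lam) z \<omega> = S \<omega> \<and> S \<omega> < \<infinity>}"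
      by eventually_elim simp
  qed auto
qed

end
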